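(* Let $B>1$, $j\in\mathbb{Z}$, $\lambda_{jk}>0$ and $\xi_{jk}\in\mathbb{S}^2$, and for $s\in\mathbb{N}$ let $\psi_{jk;s}$ be the Mexican needlet defined in the context. Then for every $s\in\mathbb{N}$ with $s>1$ and every $x\in\mathbb{S}^2$, $$\psi_{jk;s}(x)=(-1)^{s-1}B^{-2j(s-1)}\left(\Delta_{\mathbb{S}^2}\right)^{s-1}\psi_{jk;1}(x).$$
   Context: $\mathbb{N}=\{1,2,\ldots\}$. $\Delta_{\mathbb{S}^2}$ is the Laplace–Beltrami operator on the unit sphere $\mathbb{S}^2\subset\mathbb{R}^3$, with the sign convention that its eigenvalues are $e_\ell=-\ell(\ell+1)$, $\ell\ge 0$; $\{Y_{\ell m}\}_{m=-\ell}^{\ell}$ are the (orthonormal) spherical harmonics of degree $\ell$, so $\Delta_{\mathbb{S}^2}Y_{\ell m}=e_\ell Y_{\ell m}$. The weight function is $f_s(t)=t^{2s}e^{-t^2}$, $t\in\mathbb{R}$. Here $\lambda_{jk}$ is the area of a region $E_{jk}\subset\mathbb{S}^2$ in a partition of the sphere at resolution level $j$, and $\xi_{jk}\in E_{jk}$. The Mexican needlets are $$\psi_{jk;s}(x)=\sqrt{\lambda_{jk}}\sum_{\ell=0}^{\infty}f_s\!\left(\frac{\sqrt{-e_\ell}}{B^j}\right)\sum_{m=-\ell}^{\ell}\overline{Y_{\ell m}(\xi_{jk})}\,Y_{\ell m}(x),\qquad x\in\mathbb{S}^2.$$ *)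

theory Defs
  imports "HOL-Analysis.Analysis"
begin

text \<open>
  Functions on the unit sphere are represented by functions on the ambient space \<open>real ^ 3\<close>
  of which only the values on \<open>sphere 0 1\<close> matter.
\<close>

definition partial_deriv ::
  "'a::real_normed_vector \<Rightarrow> ('a \<Rightarrow> 'b::real_normed_vector) \<Rightarrow> 'a \<Rightarrow> 'b" where
  "partial_deriv b F x = vector_derivative (\<lambda>t. F (x + t *\<^sub>R b)) (at 0)"

definition laplacian ::
  "('a::euclidean_space \<Rightarrow> 'b::real_normed_vector) \<Rightarrow> 'a \<Rightarrow> 'b" where
  "laplacian F x = (\<Sum>b\<in>Basis. partial_deriv b (partial_deriv b F) x)"

text \<open>
  The Laplace--Beltrami operator of the unit sphere: the Euclidean Laplacian of the extension that
  is constant along rays, evaluated on the sphere. With this sign its eigenvalues are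
  nonpositive.
\<close>

definition laplace_beltrami ::
  "('a::euclidean_space \<Rightarrow> 'b::real_normed_vector) \<Rightarrow> 'a \<Rightarrow> 'b" where
  "laplace_beltrami f = laplacian (\<lambda>y. f (y /\<^sub>R norm y))"

text \<open>
  The surface measure of the unit sphere in \<open>real ^ 3\<close>, not normalised: the measure of a set is
  three times the volume of the solid cone over it.
\<close>

definition sphere_measure :: "(real ^ 3) measure" where
  "sphere_measure = scale_measure 3
     (distr (restrict_space lborel (cball 0 1 - {0})) (restrict_space borel (sphere 0 1))
       (\<lambda>y. y /\<^sub>R norm y))"

lemma emeasure_sphere_measure: "emeasure sphere_measure (sphere 0 1) = ennreal (4 * pi)"
proof -
  let ?M = "restrict_space lborel (cball 0 1 - {0}) :: (real ^ 3) measure"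
  let ?N = "restrict_space borel (sphere 0 1) :: (real ^ 3) measure"
  have meas: "(\<lambda>y. y /\<^sub>R norm y) \<in> measurable ?M ?N"
  proof (rule measurable_restrict_space2)
    show "(\<lambda>y. y /\<^sub>R norm y) \<in> space ?M \<rightarrow> sphere 0 1"
      by (auto simp: space_restrict_space)
    show "(\<lambda>y. y /\<^sub>R norm y) \<in> borel_measurable ?M"
      by (rule measurable_restrict_space1) measurable
  qed
  have "sphere 0 1 \<in> sets ?N"
    by (metis sets.top space_borel space_restrict_space inf_top_right)
  then have "emeasure sphere_measure (sphere 0 1) =
      3 * emeasure ?M ((\<lambda>y. y /\<^sub>R norm y) -` sphere 0 1 \<inter> space ?M)"
    unfolding sphere_measure_def by (simp add: emeasure_distr[OF meas])
  also have "(\<lambda>y. y /\<^sub>R norm y) -` sphere 0 1 \<inter> space ?M = cball 0 1 - {0}"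
    by (auto simp: space_restrict_space)
  also have "emeasure ?M (cball 0 1 - {0}) = emeasure lborel (cball 0 1 - {0} :: (real ^ 3) set)"
    by (rule emeasure_restrict_space) auto
  also have "\<dots> = emeasure lborel (cball 0 1 :: (real ^ 3) set)"
    by (rule emeasure_Diff_null_set) auto
  also have "\<dots> = ennreal (4 / 3 * pi)"
    using emeasure_cball[of 1 "0 :: real ^ 3"] unit_ball_vol_3 by simp
  also have "3 * ennreal (4 / 3 * pi) = ennreal (4 * pi)"
    using ennreal_mult[of 3 "4 / 3 * pi"] by simp
  finally show ?thesis .
qed

definition spherical_harmonic :: "nat \<Rightarrow> (real ^ 3 \<Rightarrow> complex) \<Rightarrow> bool" where
  "spherical_harmonic l Y \<longleftrightarrow>
     (\<exists>p. polynomial_function p \<and> (\<forall>t x. p (t *\<^sub>R x) = t ^ l *\<^sub>R p x) \<and>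
          (\<forall>x. laplacian p x = 0) \<and> (\<forall>x\<in>sphere 0 1. Y x = p x))"

text \<open>Since there are \<open>2 * l + 1\<close> indices \<open>m\<close> for each degree \<open>l\<close>, the orthonormal
  family \<open>Y l m\<close> is automatically a basis of the spherical harmonics of degree \<open>l\<close>.\<close>

definition orthonormal_spherical_harmonics :: "(nat \<Rightarrow> int \<Rightarrow> real ^ 3 \<Rightarrow> complex) \<Rightarrow> bool" where
  "orthonormal_spherical_harmonics Y \<longleftrightarrow>
     (\<forall>l. \<forall>m\<in>{-int l..int l}. spherical_harmonic l (Y l m)) \<and>
     (\<forall>l l'. \<forall>m\<in>{-int l..int l}. \<forall>m'\<in>{-int l'..int l'}.
        (\<integral>x. Y l m x * cnj (Y l' m' x) \<partial>sphere_measure) = of_bool (l = l' \<and> m = m'))"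

definition sphere_eigenvalue :: "nat \<Rightarrow> real" where
  "sphere_eigenvalue l = - (real l * (real l + 1))"

definition mexican_weight :: "nat \<Rightarrow> real \<Rightarrow> real" where
  "mexican_weight s t = t ^ (2 * s) * exp (- t\<^sup>2)"

text \<open>Here \<open>a\<close> is the area and \<open>\<xi>\<close> the chosen point of the region that
  indexes the needlet; \<open>j\<close> is the resolution level.\<close>

definition mexican_needlet ::
  "(nat \<Rightarrow> int \<Rightarrow> real ^ 3 \<Rightarrow> complex) \<Rightarrow> real \<Rightarrow> int \<Rightarrow> real \<Rightarrow> real ^ 3 \<Rightarrow> nat \<Rightarrow> real ^ 3 \<Rightarrow> complex"
where
  "mexican_needlet Y B j a \<xi> s x =
     of_real (sqrt a) *
     (\<Sum>l. of_real (mexican_weight s (sqrt (- sphere_eigenvalue l) / B powi j)) *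
          (\<Sum>m\<in>{-int l..int l}. cnj (Y l m \<xi>) * Y l m x))"

end

theory Submission
  imports Defs "HOL-Complex_Analysis.Complex_Analysis" "HOL-Real_Asymp.Real_Asymp"
begin

text \<open>
  Spherical harmonics are eigenfunctions of the Laplace--Beltrami operator, so the identity holds
  term by term and everything rests on differentiating the series twice. As the weights decay like
  \<open>exp (- c * l\<^sup>2)\<close>, it suffices to bound the degree \<open>l\<close> terms by \<open>C ^ l\<close>
  on a complex neighbourhood of each line through \<open>x\<close>; locally uniform convergence of holomorphic
  functions then takes care of all derivatives. Along a line a homogeneous polynomial of degree
  \<open>l\<close> is a univariate polynomial of degree at most \<open>l\<close>, so real bounds extend to complex
  arguments at the price of a factor \<open>C ^ l\<close>. The same estimate gives a
  Lipschitz bound near a maximum point on the sphere, hence a bound for the maximum in terms of the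
  \<open>L\<^sup>2\<close> norm, which is 1.
\<close>

subsection \<open>Homogeneous polynomials on lines\<close>

text \<open>The restriction is packaged as a \<open>complex poly\<close> so that the real parameter
  \<open>t\<close> can later be replaced by a complex one. Real and imaginary parts are univariate
  real polynomials, whose coefficients are then combined.\<close>

lemma polynomial_function_line:
  fixes p :: "'a::real_normed_vector \<Rightarrow> complex"
  assumes "polynomial_function p"
  obtains Q :: "complex poly" where "\<And>t::real. p (x + t *\<^sub>R d) = poly Q (of_real t)"
proof -
  have line: "polynomial_function (\<lambda>t::real. x + t *\<^sub>R d)"
    by (rule polynomial_function_add[OF polynomial_function_const
          polynomial_function_mult[OF polynomial_function_id polynomial_function_const]])
  have "real_polynomial_function (Re \<circ> p)" "real_polynomial_function (Im \<circ> p)"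
    using assms bounded_linear_Re bounded_linear_Im unfolding polynomial_function_def by auto
  then have "real_polynomial_function ((Re \<circ> p) \<circ> (\<lambda>t::real. x + t *\<^sub>R d))"
    "real_polynomial_function ((Im \<circ> p) \<circ> (\<lambda>t::real. x + t *\<^sub>R d))"
    by (simp_all add: real_polynomial_function_compose[OF line])
  then obtain a b m n where
    re: "(Re \<circ> p) \<circ> (\<lambda>t::real. x + t *\<^sub>R d) = (\<lambda>t. \<Sum>i\<le>m. a i * t ^ i)" and
    im: "(Im \<circ> p) \<circ> (\<lambda>t::real. x + t *\<^sub>R d) = (\<lambda>t. \<Sum>i\<le>n. b i * t ^ i)"
    unfolding real_polynomial_function_iff_sum by blast
  let ?Q = "(\<Sum>i\<le>m. monom (of_real (a i)) i) + smult \<i> (\<Sum>i\<le>n. monom (of_real (b i)) i)"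
  have "p (x + t *\<^sub>R d) = poly ?Q (of_real t)" for t
  proof -
    have "p (x + t *\<^sub>R d) = of_real (Re (p (x + t *\<^sub>R d))) + \<i> * of_real (Im (p (x + t *\<^sub>R d)))"
      by (rule complex_eq)
    also have "\<dots> = poly ?Q (of_real t)"
      using fun_cong[OF re, of t] fun_cong[OF im, of t] by (simp add: o_def poly_sum poly_monom)
    finally show ?thesis .
  qed
  then show ?thesis using that by blast
qed

lemma poly_eq_if_eq_on_positive_reals:
  fixes P Q :: "complex poly"
  assumes "\<And>t::real. t > 0 \<Longrightarrow> poly P (of_real t) = poly Q (of_real t)"
  shows "P = Q"
proof (rule ccontr)
  assume "P \<noteq> Q"
  then have "finite {z. poly (P - Q) z = 0}" by (intro poly_roots_finite) simp
  moreover have "of_real ` {0<..} \<subseteq> {z. poly (P - Q) z = 0}" using assms by auto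
  ultimately have "finite (complex_of_real ` {0<..})" using finite_subset by blast
  then have "finite {0::real<..}" by (rule finite_imageD) (simp add: inj_on_def)
  then show False using infinite_Ioi by blast
qed

text \<open>The degree bound comes from comparing the restrictions of \<open>p\<close> to the lines
  \<open>x + t d\<close> and \<open>d + t x\<close>, which are exchanged by \<open>t \<mapsto> 1 / t\<close>.\<close>

lemma homogeneous_polynomial_function_line:
  fixes p :: "'a::real_normed_vector \<Rightarrow> complex"
  assumes p: "polynomial_function p" and hom: "\<And>t x. p (t *\<^sub>R x) = t ^ l *\<^sub>R p x"
  obtains Q :: "complex poly" where "degree Q \<le> l"
    "\<And>t::real. p (x + t *\<^sub>R d) = poly Q (of_real t)"
proof -
  obtain Q where Q: "\<And>t::real. p (x + t *\<^sub>R d) = poly Q (of_real t)"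
    using polynomial_function_line[OF p] by metis
  obtain R where R: "\<And>t::real. p (d + t *\<^sub>R x) = poly R (of_real t)"
    using polynomial_function_line[OF p] by metis
  \<comment> \<open>Homogeneity gives \<open>Q(t) = t ^ l * R(1 / t)\<close> for
    \<open>t > 0\<close>; multiplying by \<open>t ^ degree R\<close> clears the negative powers and
    turns \<open>R\<close> into its reflection. In the degree comparison below,
    \<open>degree R\<close> cancels.\<close>
  have eq: "monom 1 (degree R) * Q = monom 1 l * reflect_poly R"
  proof (rule poly_eq_if_eq_on_positive_reals)
    fix t :: real assume t: "t > 0"
    have "x + t *\<^sub>R d = t *\<^sub>R (d + inverse t *\<^sub>R x)"
      using t by (simp add: scaleR_add_right)
    then have "poly Q (of_real t) = of_real t ^ l * poly R (inverse (of_real t))"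
      using R[of "inverse t"] hom[of t "d + inverse t *\<^sub>R x"] Q[of t] by (simp add: scaleR_conv_of_real)
    then show "poly (monom 1 (degree R) * Q) (of_real t) = poly (monom 1 l * reflect_poly R) (of_real t)"
      using t by (simp add: poly_monom poly_reflect_poly_nz)
  qed
  have "degree Q \<le> l"
  proof (cases "Q = 0")
    case False
    then have "R \<noteq> 0" using eq by (metis reflect_poly_0 mult_zero_right mult_eq_0_iff monom_eq_0_iff one_neq_zero)
    have "degree R + degree Q = degree (monom 1 (degree R) * Q)"
      using False by (simp add: degree_mult_eq degree_monom_eq monom_eq_0_iff)
    also have "\<dots> = l + degree (reflect_poly R)"
      unfolding eq using \<open>R \<noteq> 0\<close> by (simp add: degree_mult_eq degree_monom_eq monom_eq_0_iff)
    also have "\<dots> \<le> l + degree R"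
      by (simp add: degree_reflect_poly_le)
    finally show ?thesis by simp
  qed simp
  then show ?thesis using Q by (rule that)
qed

text \<open>After the Joukowski substitution \<open>z = (w + 1 / w) / 2\<close> the unit circle covers
  \<open>[-1, 1]\<close>, and \<open>w ^ l * poly Q z\<close> is a polynomial in \<open>w\<close>, to
  which the maximum principle applies.\<close>

lemma poly_bound_from_interval:
  fixes Q :: "complex poly"
  assumes deg: "degree Q \<le> l" and M: "\<And>t::real. \<bar>t\<bar> \<le> 1 \<Longrightarrow> cmod (poly Q (of_real t)) \<le> M"
    and z: "cmod z \<le> 1"
  shows "cmod (poly Q z) \<le> (5 / 2) ^ l * M"
proof -
  \<comment> \<open>This is \<open>w ^ l * poly Q ((w + 1 / w) / 2)\<close> with the negative powers
    cleared, so that it is holomorphic at \<open>w = 0\<close> as well.\<close>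
  define P where "P w = (\<Sum>k\<le>l. coeff Q k * (w\<^sup>2 + 1) ^ k / 2 ^ k * w ^ (l - k))" for w
  have P: "P w = w ^ l * poly Q ((w + inverse w) / 2)" if "w \<noteq> 0" for w
  proof -
    have "poly Q ((w + inverse w) / 2) = (\<Sum>k\<le>l. coeff Q k * ((w + inverse w) / 2) ^ k)"
      unfolding poly_altdef by (rule sum.mono_neutral_left) (use deg in \<open>auto simp: coeff_eq_0\<close>)
    moreover have "w ^ l * (coeff Q k * ((w + inverse w) / 2) ^ k)
        = coeff Q k * (w\<^sup>2 + 1) ^ k / 2 ^ k * w ^ (l - k)" if "k \<le> l" for k
    proof -
      have split: "w ^ l = w ^ k * w ^ (l - k)" using that by (simp flip: power_add)
      have "w * ((w + inverse w) / 2) = (w\<^sup>2 + 1) / 2"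
        using \<open>w \<noteq> 0\<close> by (simp add: field_simps power2_eq_square)
      then have k: "w ^ k * ((w + inverse w) / 2) ^ k = (w\<^sup>2 + 1) ^ k / 2 ^ k"
        by (simp flip: power_mult_distrib power_divide)
      have "w ^ l * (coeff Q k * ((w + inverse w) / 2) ^ k)
          = coeff Q k * (w ^ k * ((w + inverse w) / 2) ^ k) * w ^ (l - k)"
        unfolding split by (simp only: mult_ac)
      then show ?thesis unfolding k by simp
    qed
    ultimately show ?thesis unfolding P_def by (simp add: sum_distrib_left)
  qed
  have bound: "cmod (P w) \<le> M" if "cmod w \<le> 1" for w
  proof (rule maximum_modulus_frontier[where S = "cball 0 1" and f = P and \<xi> = w])
    show "P holomorphic_on interior (cball 0 1)" "continuous_on (closure (cball 0 1)) P"
      unfolding P_def by (intro holomorphic_intros continuous_intros; simp)+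
    show "bounded (cball (0::complex) 1)" "w \<in> cball 0 1" using that by auto
    fix u :: complex assume "u \<in> frontier (cball 0 1)"
    then have u: "cmod u = 1" by simp
    \<comment> \<open>On the unit circle the Joukowski image of \<open>u\<close> is
      \<open>Re u\<close>, a point of [-1, 1], where the bound \<open>M\<close> is
      available.\<close>
    then have "inverse u = cnj u"
      using complex_norm_square[of u] by (intro inverse_unique) simp
    then have "(u + inverse u) / 2 = of_real (Re u)" by (simp add: complex_add_cnj)
    moreover have "\<bar>Re u\<bar> \<le> 1" using abs_Re_le_cmod[of u] u by simp
    moreover have "u \<noteq> 0" using u by auto
    ultimately show "cmod (P u) \<le> M"
      using P[of u] M[of "Re u"] u by (simp add: norm_mult norm_power)
  qed
  obtain w where w: "w \<noteq> 0" "cmod w \<le> 1" "cmod (inverse w) \<le> 5 / 2" "(w + inverse w) / 2 = z"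
  proof -
    \<comment> \<open>The Joukowski preimages of \<open>z\<close> are \<open>z + r\<close> and
      \<open>z - r\<close>. They are inverse to each other, so one of them lies in the closed unit
      disc, and both have modulus at most \<open>1 + 3 / 2\<close>.\<close>
    define r where "r = csqrt (z\<^sup>2 - 1)"
    have r: "(z + r) * (z - r) = 1" unfolding r_def
      using power2_csqrt[of "z\<^sup>2 - 1"] by (simp add: algebra_simps power2_eq_square)
    have "cmod r \<le> 3 / 2"
    proof -
      have "cmod (z\<^sup>2 - 1) \<le> 2"
        using norm_triangle_ineq4[of "z\<^sup>2" 1] z power_le_one[of "cmod z" 2] by (simp add: norm_power)
      moreover have "(cmod r)\<^sup>2 = cmod (z\<^sup>2 - 1)"
        unfolding r_def by (metis norm_power power2_csqrt)
      moreover have "(2::real) \<le> (3 / 2)\<^sup>2" by (simp add: power2_eq_square)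
      ultimately have "(cmod r)\<^sup>2 \<le> (3 / 2)\<^sup>2" by linarith
      then show ?thesis by (rule power2_le_imp_le) simp
    qed
    then have *: "cmod (z + r) \<le> 5 / 2" "cmod (z - r) \<le> 5 / 2"
      using norm_triangle_ineq[of z r] norm_triangle_ineq4[of z r] z by auto
    have "cmod (z + r) * cmod (z - r) = 1" using r by (metis norm_mult norm_one)
    then have "cmod (z + r) \<le> 1 \<or> cmod (z - r) \<le> 1"
      using less_1_mult[of "cmod (z + r)" "cmod (z - r)"] by linarith
    moreover have "inverse (z + r) = z - r" "inverse (z - r) = z + r"
      using r by (auto intro: inverse_unique simp: mult.commute)
    moreover have "z + r \<noteq> 0" "z - r \<noteq> 0" using r by auto
    ultimately show ?thesis using that[of "z + r"] that[of "z - r"] * by auto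
  qed
  have "poly Q z = inverse w ^ l * P w" using P[OF w(1)] w by (simp add: field_simps)
  then have "cmod (poly Q z) = cmod (inverse w) ^ l * cmod (P w)"
    by (simp add: norm_mult norm_power)
  also have "\<dots> \<le> (5 / 2) ^ l * M"
    using w bound[OF w(2)] by (intro mult_mono power_mono) auto
  finally show ?thesis .
qed

subsection \<open>Partial derivatives and radial extensions\<close>

lemma partial_deriv_eq_has_derivative:
  assumes "(F has_derivative D) (at x)"
  shows "partial_deriv b F x = D b"
proof -
  have "((\<lambda>t. x + t *\<^sub>R b) has_derivative (\<lambda>t. t *\<^sub>R b)) (at 0)"
    by (auto intro!: derivative_eq_intros)
  then have "((\<lambda>t. F (x + t *\<^sub>R b)) has_derivative (\<lambda>t. D (t *\<^sub>R b))) (at 0)"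
    by (rule has_derivative_compose) (use assms in simp)
  moreover have "D (t *\<^sub>R b) = t *\<^sub>R D b" for t
    using assms by (simp add: has_derivative_bounded_linear linear_scale bounded_linear.linear)
  ultimately show ?thesis
    unfolding partial_deriv_def by (intro vector_derivative_at) (simp add: has_vector_derivative_def)
qed

text \<open>Stated at every point of the segment, not only at \<open>t = 0\<close>, so that it can
  be applied a second time to the partial derivative itself.\<close>

lemma partial_deriv_along_line:
  fixes F :: "'a::real_normed_vector \<Rightarrow> complex"
  assumes G: "G holomorphic_on ball 0 \<delta>" and t: "\<bar>t\<bar> < \<delta>"
    and eq: "\<And>t::real. \<bar>t\<bar> < \<delta> \<Longrightarrow> F (x + t *\<^sub>R b) = G (of_real t)"
  shows "partial_deriv b F (x + t *\<^sub>R b) = deriv G (of_real t)"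
proof -
  have "(G has_field_derivative deriv G (of_real t)) (at (of_real t))"
    using G t by (intro holomorphic_derivI[where S = "ball 0 \<delta>"]) auto
  then have "((\<lambda>u. G (of_real u + of_real t)) has_vector_derivative deriv G (of_real t)) (at (0::real))"
    using DERIV_shift[of G _ 0 "of_real t"] by (intro has_vector_derivative_real_field) simp
  then have "((\<lambda>u. F (x + t *\<^sub>R b + u *\<^sub>R b)) has_vector_derivative deriv G (of_real t)) (at 0)"
  proof (rule has_vector_derivative_transform_within_open)
    show "open {-(\<delta> - \<bar>t\<bar>)<..<\<delta> - \<bar>t\<bar>}" "0 \<in> {-(\<delta> - \<bar>t\<bar>)<..<\<delta> - \<bar>t\<bar>}" using t by auto
    fix u assume "u \<in> {-(\<delta> - \<bar>t\<bar>)<..<\<delta> - \<bar>t\<bar>}"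
    then have "\<bar>t + u\<bar> < \<delta>" by auto
    then show "G (of_real u + of_real t) = F (x + t *\<^sub>R b + u *\<^sub>R b)"
      using eq[of "t + u"] by (simp add: scaleR_add_left add_ac)
  qed
  then show ?thesis unfolding partial_deriv_def by (rule vector_derivative_at)
qed

text \<open>The Laplacian sees a function only through its restrictions to coordinate lines, so its
  terms can be read off a holomorphic continuation on each line.\<close>

lemma partial_deriv_twice_along_line:
  fixes F :: "'a::real_normed_vector \<Rightarrow> complex"
  assumes G: "G holomorphic_on ball 0 \<delta>" and \<delta>: "\<delta> > 0"
    and eq: "\<And>t::real. \<bar>t\<bar> < \<delta> \<Longrightarrow> F (x + t *\<^sub>R b) = G (of_real t)"
  shows "partial_deriv b (partial_deriv b F) x = deriv (deriv G) 0"
proof -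
  have "deriv G holomorphic_on ball 0 \<delta>" using G by (rule holomorphic_deriv) auto
  from partial_deriv_along_line[OF this _ partial_deriv_along_line[OF G _ eq], of 0]
  show ?thesis using \<delta> by simp
qed

text \<open>If \<open>poly Q t\<close> is a function homogeneous of degree \<open>l\<close> at
  \<open>x + t d\<close>, with \<open>x\<close> and \<open>d\<close> unit vectors and \<open>c = x \<bullet> d\<close>, then
  \<open>radial_line l c Q\<close> is the holomorphic continuation of the same function
  at \<open>(x + t d) / norm (x + t d)\<close>, because \<open>norm (x + t d)\<^sup>2 = 1 + 2 c t + t\<^sup>2\<close>.\<close>

definition radial_line :: "nat \<Rightarrow> real \<Rightarrow> complex poly \<Rightarrow> complex \<Rightarrow> complex" where
  "radial_line l c Q z = poly Q z * exp (- (of_nat l / 2) * Ln (1 + 2 * of_real c * z + z\<^sup>2))"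

text \<open>Keeps \<open>1 + 2 c z + z^2\<close> in the disc of radius 3/4 about 1: away from the
  branch cut of \<open>Ln\<close>, and of modulus at least 1/4.\<close>

lemma quadratic_near_one:
  assumes "\<bar>c\<bar> \<le> 1" "cmod z < 1 / 4"
  shows "cmod (2 * of_real c * z + z\<^sup>2) \<le> 3 / 4"
proof -
  have "cmod (2 * of_real c * z + z\<^sup>2) \<le> 2 * \<bar>c\<bar> * cmod z + (cmod z)\<^sup>2"
    using norm_triangle_ineq[of "2 * of_real c * z" "z\<^sup>2"] by (simp add: norm_mult norm_power)
  also have "\<dots> \<le> 2 * 1 * (1 / 4) + (1 / 4)\<^sup>2"
    using assms by (intro add_mono mult_mono power_mono) auto
  finally show ?thesis by (simp add: power2_eq_square)
qed

lemma quadratic_slit: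
  assumes "\<bar>c\<bar> \<le> 1" "cmod z < 1 / 4"
  shows "1 + 2 * of_real c * z + z\<^sup>2 \<notin> \<real>\<^sub>\<le>\<^sub>0"
  using quadratic_near_one[OF assms] abs_Re_le_cmod[of "2 * of_real c * z + z\<^sup>2"]
  by (auto simp: complex_nonpos_Reals_iff add.assoc)

lemma has_field_derivative_radial_line:
  assumes "\<bar>c\<bar> \<le> 1" "cmod z < 1 / 4"
  shows "(radial_line l c Q has_field_derivative
      (poly (pderiv Q) z - of_nat l * (of_real c + z) / (1 + 2 * of_real c * z + z\<^sup>2) * poly Q z) *
      exp (- (of_nat l / 2) * Ln (1 + 2 * of_real c * z + z\<^sup>2))) (at z)"
proof -
  define N where "N = 1 + 2 * of_real c * z + z\<^sup>2"
  define E where "E = exp (- (of_nat l / 2) * Ln N)"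
  have "N \<notin> \<real>\<^sub>\<le>\<^sub>0" unfolding N_def by (rule quadratic_slit[OF assms])
  then have "N \<noteq> 0" by auto
  have "((\<lambda>z. 1 + 2 * of_real c * z + z\<^sup>2) has_field_derivative 2 * (of_real c + z)) (at z)"
    by (auto intro!: derivative_eq_intros)
  then have "((\<lambda>z. Ln (1 + 2 * of_real c * z + z\<^sup>2)) has_field_derivative
      inverse N * (2 * (of_real c + z))) (at z)"
    unfolding N_def
    by (rule DERIV_chain2[OF has_field_derivative_Ln, rotated]) (rule quadratic_slit[OF assms])
  then have "((\<lambda>z. exp (- (of_nat l / 2) * Ln (1 + 2 * of_real c * z + z\<^sup>2))) has_field_derivative
      E * (- (of_nat l / 2) * (inverse N * (2 * (of_real c + z))))) (at z)"
    unfolding E_def N_def by (intro DERIV_fun_exp DERIV_cmult)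
  from DERIV_mult[OF poly_DERIV[of Q] this]
  have "(radial_line l c Q has_field_derivative
      poly (pderiv Q) z * E + E * (- (of_nat l / 2) * (inverse N * (2 * (of_real c + z)))) * poly Q z)
      (at z)"
    unfolding radial_line_def[abs_def] E_def N_def .
  also have "poly (pderiv Q) z * E + E * (- (of_nat l / 2) * (inverse N * (2 * (of_real c + z)))) * poly Q z
      = (poly (pderiv Q) z - of_nat l * (of_real c + z) / N * poly Q z) * E"
    using \<open>N \<noteq> 0\<close> by (simp add: field_simps)
  finally show ?thesis unfolding E_def N_def .
qed

lemma holomorphic_radial_line:
  assumes "\<bar>c\<bar> \<le> 1"
  shows "radial_line l c Q holomorphic_on ball 0 (1 / 4)"
  unfolding holomorphic_on_open[OF open_ball]
  using has_field_derivative_radial_line[OF assms] by (metis mem_ball_0)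

text \<open>Product rule for \<open>Q * N powr (- l / 2)\<close> with
  \<open>N = 1 + 2 c z + z^2\<close>: at 0 the second factor has value 1, first derivative
  \<open>- l c\<close> and second derivative \<open>l (l + 2) c^2 - l\<close>.\<close>

lemma deriv_deriv_radial_line:
  assumes c: "\<bar>c\<bar> \<le> 1"
  shows "deriv (deriv (radial_line l c Q)) 0 =
    poly (pderiv (pderiv Q)) 0 - 2 * of_nat l * of_real c * poly (pderiv Q) 0 +
    (of_nat l * (of_nat l + 2) * (of_real c)\<^sup>2 - of_nat l) * poly Q 0"
proof (rule DERIV_imp_deriv)
  let ?N = "\<lambda>z. 1 + 2 * of_real c * z + z\<^sup>2"
  let ?D = "\<lambda>z. (poly (pderiv Q) z - of_nat l * (of_real c + z) / ?N z * poly Q z) *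
      exp (- (of_nat l / 2) * Ln (?N z))"
  have "(?D has_field_derivative
      poly (pderiv (pderiv Q)) 0 - 2 * of_nat l * of_real c * poly (pderiv Q) 0 +
    (of_nat l * (of_nat l + 2) * (of_real c)\<^sup>2 - of_nat l) * poly Q 0) (at 0)"
    by (rule derivative_eq_intros poly_DERIV refl | simp)+
      (simp add: algebra_simps power2_eq_square)
  then show "(deriv (radial_line l c Q) has_field_derivative
      poly (pderiv (pderiv Q)) 0 - 2 * of_nat l * of_real c * poly (pderiv Q) 0 +
    (of_nat l * (of_nat l + 2) * (of_real c)\<^sup>2 - of_nat l) * poly Q 0) (at 0)"
  proof (rule has_field_derivative_transform_within_open[where S = "ball 0 (1 / 4)"])
    show "?D z = deriv (radial_line l c Q) z" if "z \<in> ball 0 (1 / 4)" for z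
      using has_field_derivative_radial_line[OF c, of z] that by (metis DERIV_imp_deriv mem_ball_0)
  qed auto
qed

text \<open>The quadratic has modulus at least 1/4, so its power with exponent
  \<open>- l / 2\<close> has modulus at most \<open>2 ^ l\<close>.\<close>

lemma norm_radial_line_le:
  assumes c: "\<bar>c\<bar> \<le> 1" and z: "cmod z < 1 / 4"
  shows "cmod (radial_line l c Q z) \<le> 2 ^ l * cmod (poly Q z)"
proof -
  let ?N = "1 + 2 * of_real c * z + z\<^sup>2"
  have N: "cmod ?N \<ge> 1 / 4"
    using quadratic_near_one[OF c z] norm_diff_ineq[of 1 "2 * of_real c * z + z\<^sup>2"]
    by (simp add: add.assoc)
  have "?N \<noteq> 0" using quadratic_slit[OF c z] by force
  have "cmod (exp (- (of_nat l / 2) * Ln ?N)) = exp (real l * (- ln (cmod ?N) / 2))"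
    using \<open>?N \<noteq> 0\<close> by (simp add: norm_exp_eq_Re)
  also have "\<dots> \<le> exp (real l * ln 2)"
  proof -
    have "ln (1 / 4) \<le> ln (cmod ?N)" using N by (subst ln_le_cancel_iff) auto
    moreover have "ln (1 / 4 :: real) = - 2 * ln 2"
      using ln_realpow[of 2 2] by (simp add: ln_div)
    ultimately have "- ln (cmod ?N) / 2 \<le> ln 2" by simp
    then have "real l * (- ln (cmod ?N) / 2) \<le> real l * ln 2" by (rule mult_left_mono) simp
    then show ?thesis by simp
  qed
  also have "\<dots> = 2 ^ l" by (simp add: exp_of_nat_mult)
  finally show ?thesis
    unfolding radial_line_def by (simp add: norm_mult mult.commute mult_left_mono)
qed

lemma radial_line_of_real:
  fixes p :: "'a::real_inner \<Rightarrow> complex"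
  assumes hom: "\<And>t x. p (t *\<^sub>R x) = t ^ l *\<^sub>R p x"
    and Q: "\<And>t::real. p (x + t *\<^sub>R d) = poly Q (of_real t)"
    and x: "norm x = 1" and d: "norm d = 1" and t: "\<bar>t\<bar> < 1"
  shows "p ((x + t *\<^sub>R d) /\<^sub>R norm (x + t *\<^sub>R d)) = radial_line l (x \<bullet> d) Q (of_real t)"
proof -
  define n where "n = norm (x + t *\<^sub>R d)"
  have n: "n > 0"
    using norm_diff_ineq[of x "t *\<^sub>R d"] x d t by (simp add: n_def del: zero_less_norm_iff)
  have "n\<^sup>2 = 1 + 2 * (x \<bullet> d) * t + t\<^sup>2"
    using x d unfolding n_def power2_norm_eq_inner norm_eq_1
    by (simp add: inner_add inner_commute algebra_simps power2_eq_square)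
  then have "1 + 2 * of_real (x \<bullet> d) * of_real t + (of_real t)\<^sup>2 = complex_of_real (n\<^sup>2)"
    by simp
  then have "exp (- (of_nat l / 2) * Ln (1 + 2 * of_real (x \<bullet> d) * of_real t + (of_real t)\<^sup>2))
      = exp (of_real (- real l * ln n))"
    using n by (simp add: Ln_of_real ln_realpow del: of_real_power)
  also have "\<dots> = of_real (inverse n ^ l)"
    using n by (simp add: exp_of_real exp_minus exp_of_nat_mult power_inverse)
  finally show ?thesis
    unfolding radial_line_def hom n_def[symmetric] Q by (simp add: scaleR_conv_of_real mult.commute)
qed

text \<open>Euler's identity, obtained by differentiating
  \<open>p ((1 + t) x) = (1 + t) ^ l p x\<close> at \<open>t = 0\<close>.\<close>

lemma euler_homogeneous:
  assumes D: "(p has_derivative D) (at x)" and hom: "\<And>t x. p (t *\<^sub>R x) = t ^ l *\<^sub>R p x"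
  shows "D x = real l *\<^sub>R p x"
proof -
  have "p (x + t *\<^sub>R x) = (1 + t) ^ l *\<^sub>R p x" for t
    using hom[of "1 + t" x] by (simp add: scaleR_add_left)
  moreover have "((\<lambda>t. (1 + t) ^ l *\<^sub>R p x) has_vector_derivative real l *\<^sub>R p x) (at 0)"
    by (auto intro!: derivative_eq_intros simp: has_vector_derivative_def)
  ultimately have "partial_deriv x p x = real l *\<^sub>R p x"
    unfolding partial_deriv_def by (simp only: vector_derivative_at)
  then show ?thesis using partial_deriv_eq_has_derivative[OF D] by simp
qed

text \<open>The eigenvalue computation: the left side is the Laplacian at \<open>x\<close> of the
  extension constant along rays. Summing the second derivatives over the basis, harmonicity removes
  the pure second derivatives, Euler's identity turns the mixed terms into \<open>- 2 l^2\<close>,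
  and the squared coordinates of \<open>x\<close> add up to 1. In dimension 3 the result is
  \<open>- l (l + 1)\<close>.\<close>

lemma sum_deriv_deriv_radial_line:
  fixes p :: "'a::euclidean_space \<Rightarrow> complex"
  assumes p: "polynomial_function p" and hom: "\<And>t x. p (t *\<^sub>R x) = t ^ l *\<^sub>R p x"
    and harmonic: "laplacian p x = 0" and x: "norm x = 1"
    and Q: "\<And>b t. b \<in> Basis \<Longrightarrow> p (x + t *\<^sub>R b) = poly (Q b) (of_real t)"
  shows "(\<Sum>b\<in>Basis. deriv (deriv (radial_line l (x \<bullet> b) (Q b))) 0) =
    - of_nat l * (of_nat l + of_nat DIM('a) - 2) * p x"
proof -
  obtain D where D: "(p has_derivative D) (at x)"
    using differentiable_at_polynomial_function[OF p] unfolding differentiable_def by blast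
  have lin: "linear D" using D by (simp add: has_derivative_bounded_linear bounded_linear.linear)
  have hol: "poly q holomorphic_on ball 0 1" for q :: "complex poly"
    by (auto intro!: holomorphic_intros)
  have deriv_poly: "deriv (poly q) = poly (pderiv q)" for q :: "complex poly"
    by (auto intro!: DERIV_imp_deriv poly_DERIV)
  have Q0: "poly (Q b) 0 = p x" if "b \<in> Basis" for b using Q[OF that, of 0] by simp
  have Q1: "poly (pderiv (Q b)) 0 = D b" if "b \<in> Basis" for b
    using partial_deriv_along_line[OF hol[of "Q b"], of 0 p x b] Q[OF that]
      partial_deriv_eq_has_derivative[OF D] by (simp add: deriv_poly)
  have Q2: "poly (pderiv (pderiv (Q b))) 0 = partial_deriv b (partial_deriv b p) x" if "b \<in> Basis" for b
    using partial_deriv_twice_along_line[OF hol[of "Q b"], of p x b] Q[OF that]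
    by (simp add: deriv_poly)
  have c: "\<bar>x \<bullet> b\<bar> \<le> 1" if "b \<in> Basis" for b
    using Basis_le_norm[OF that, of x] x by simp
  have "(\<Sum>b\<in>Basis. of_real (x \<bullet> b) * D b) = D (\<Sum>b\<in>Basis. (x \<bullet> b) *\<^sub>R b)"
    using lin by (simp add: linear_sum linear_scale scaleR_conv_of_real)
  also have "\<dots> = of_nat l * p x"
    using euler_homogeneous[OF D hom] by (simp add: euclidean_representation scaleR_conv_of_real)
  finally have euler: "(\<Sum>b\<in>Basis. of_real (x \<bullet> b) * D b) = of_nat l * p x" .
  have "(\<Sum>b\<in>Basis. (x \<bullet> b)\<^sup>2) = 1"
    using euclidean_inner[of x x] x by (simp add: norm_eq_1 power2_eq_square)
  then have sq: "(\<Sum>b\<in>Basis. (of_real (x \<bullet> b))\<^sup>2) = (1::complex)"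
    by (metis (no_types, lifting) of_real_1 of_real_power of_real_sum sum.cong)
  have "(\<Sum>b\<in>Basis. deriv (deriv (radial_line l (x \<bullet> b) (Q b))) 0) =
      (\<Sum>b\<in>Basis. partial_deriv b (partial_deriv b p) x
        - 2 * of_nat l * (of_real (x \<bullet> b) * D b)
        + of_nat l * (of_nat l + 2) * p x * (of_real (x \<bullet> b))\<^sup>2 - of_nat l * p x)"
    by (intro sum.cong refl)
      (simp add: deriv_deriv_radial_line[OF c] Q0 Q1 Q2 algebra_simps)
  also have "\<dots> = laplacian p x - 2 * of_nat l * (of_nat l * p x)
      + of_nat l * (of_nat l + 2) * p x - of_nat DIM('a) * (of_nat l * p x)"
    unfolding laplacian_def
    by (simp add: sum.distrib sum_subtractf euler sq flip: sum_distrib_left)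
  finally show ?thesis unfolding harmonic by (simp add: algebra_simps)
qed

section \<open>Growth of homogeneous polynomials on complex lines and near a maximum point\<close>

text \<open>For real \<open>t\<close> in [-1, 1] the point \<open>x + t d\<close> has norm at most
  2, which costs \<open>2 ^ l\<close> by homogeneity; passing to the complex disc costs another
  \<open>(5 / 2) ^ l\<close>.\<close>

lemma homogeneous_polynomial_line_bound:
  fixes p :: "'a::real_normed_vector \<Rightarrow> complex"
  assumes hom: "\<And>t x. p (t *\<^sub>R x) = t ^ l *\<^sub>R p x"
    and Q: "degree Q \<le> l" "\<And>t::real. p (x + t *\<^sub>R d) = poly Q (of_real t)"
    and x: "norm x = 1" and d: "norm d = 1" and z: "cmod z \<le> 1"
    and M: "\<And>y. norm y = 1 \<Longrightarrow> cmod (p y) \<le> M"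
  shows "cmod (poly Q z) \<le> 5 ^ l * M"
proof -
  have "cmod (poly Q (of_real t)) \<le> 2 ^ l * M" if t: "\<bar>t\<bar> \<le> 1" for t
  proof -
    let ?y = "x + t *\<^sub>R d"
    obtain u where u: "norm u = 1" "?y = norm ?y *\<^sub>R u"
    proof (cases "?y = 0")
      case True
      then show ?thesis using that[of x] x by simp
    next
      case False
      then show ?thesis using that[of "?y /\<^sub>R norm ?y"] by simp
    qed
    have "norm ?y \<le> 2" using norm_triangle_ineq[of x "t *\<^sub>R d"] x d t by simp
    moreover have "cmod (p ?y) = norm ?y ^ l * cmod (p u)" by (subst u) (simp add: hom)
    ultimately show ?thesis
      using M[OF u(1)] by (simp add: mult_mono power_mono flip: Q(2))
  qed
  then have "cmod (poly Q z) \<le> (5 / 2) ^ l * (2 ^ l * M)"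
    using Q(1) z by (intro poly_bound_from_interval)
  also have "\<dots> = 5 ^ l * M" by (simp add: power_divide)
  finally show ?thesis .
qed

text \<open>By the Schwarz lemma the polynomial is Lipschitz at \<open>x\<close> along each line,
  with a constant proportional to its maximum on the sphere. A step of length at most
  \<open>1 / (6 * 5 ^ l)\<close> therefore changes the value by at most half of that
  maximum.\<close>

lemma homogeneous_polynomial_near_max:
  fixes p :: "'a::real_normed_vector \<Rightarrow> complex"
  assumes p: "polynomial_function p" and hom: "\<And>t x. p (t *\<^sub>R x) = t ^ l *\<^sub>R p x"
    and x: "norm x = 1" and max: "\<And>y. norm y = 1 \<Longrightarrow> cmod (p y) \<le> cmod (p x)"
    and y: "norm (y - x) \<le> 1 / (6 * 5 ^ l)"
  shows "cmod (p x) / 2 \<le> cmod (p y)"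
proof (cases "y = x \<or> p x = 0")
  case False
  define h where "h = norm (y - x)"
  define d where "d = (y - x) /\<^sub>R h"
  \<comment> \<open>The oscillation of \<open>Q\<close> on the unit disc is at most
    \<open>2 * 5 ^ l * cmod (p x)\<close>; the factor 3 supplies the strict inequality that the
    Schwarz lemma requires.\<close>
  define K where "K = 3 * 5 ^ l * cmod (p x)"
  have h: "h > 0" "norm d = 1" "x + h *\<^sub>R d = y" using False by (auto simp: h_def d_def)
  have "(1::real) \<le> 5 ^ l" by simp
  then have "(1::real) < 6 * 5 ^ l" by linarith
  then have "1 / (6 * 5 ^ l) < (1::real)" by simp
  then have h1: "h < 1" using y unfolding h_def by (rule le_less_trans[rotated])
  have K: "K > 0" using False by (simp add: K_def)
  obtain Q where Q: "degree Q \<le> l" "\<And>t::real. p (x + t *\<^sub>R d) = poly Q (of_real t)"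
    using homogeneous_polynomial_function_line[OF p hom] by metis
  have bound: "cmod (poly Q z) \<le> 5 ^ l * cmod (p x)" if "cmod z \<le> 1" for z
    using homogeneous_polynomial_line_bound[OF hom Q x h(2) that max] .
  have "cmod ((poly Q (of_real h) - poly Q 0) / of_real K) \<le> cmod (of_real h)"
  proof (rule Schwarz_Lemma(1)[where f = "\<lambda>z. (poly Q z - poly Q 0) / of_real K"])
    show "(\<lambda>z. (poly Q z - poly Q 0) / of_real K) holomorphic_on ball 0 1"
      using K by (auto intro!: holomorphic_intros)
    fix z :: complex assume "cmod z < 1"
    then have "cmod (poly Q z - poly Q 0) \<le> 2 * (5 ^ l * cmod (p x))"
      using bound[of z] bound[of 0] norm_triangle_ineq4[of "poly Q z" "poly Q 0"] by simp
    also have "\<dots> < K" using False by (simp add: K_def)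
    finally show "cmod ((poly Q z - poly Q 0) / of_real K) < 1"
      using K by (simp add: norm_divide)
  qed (use h1 h in auto)
  then have "cmod (poly Q (of_real h) - poly Q 0) \<le> K * h"
    using K h by (simp add: norm_divide field_simps)
  also have "\<dots> \<le> K * (1 / (6 * 5 ^ l))"
    using K y by (intro mult_left_mono) (auto simp: h_def)
  also have "\<dots> = cmod (p x) / 2" by (simp add: K_def)
  finally have "cmod (p y - p x) \<le> cmod (p x) / 2"
    using Q(2)[of h] Q(2)[of 0] h by simp
  then show ?thesis using norm_triangle_ineq2[of "p x" "p y"] by (simp add: norm_minus_commute)
qed auto

subsection \<open>Bounds from the L2 normalisation\<close>

lemma space_sphere_measure: "space sphere_measure = sphere 0 1"
  by (simp add: sphere_measure_def space_scale_measure space_restrict_space)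

lemma sets_sphere_measure: "sets sphere_measure = sets (restrict_space borel (sphere 0 1))"
  by (simp add: sphere_measure_def)

text \<open>Apart from the origin, a null set, \<open>U\<close> lies in the solid cone over
  \<open>S\<close>. A Euclidean ball can thus stand in for a spherical cap when measures are bounded
  from below.\<close>

lemma emeasure_sphere_measure_ge:
  assumes S: "S \<in> sets sphere_measure" and U: "U \<in> sets borel" "U \<subseteq> cball 0 1"
    and US: "\<And>y. y \<in> U \<Longrightarrow> y \<noteq> 0 \<Longrightarrow> y /\<^sub>R norm y \<in> S"
  shows "3 * emeasure lborel U \<le> emeasure sphere_measure S"
proof -
  let ?M = "restrict_space lborel (cball 0 1 - {0}) :: (real ^ 3) measure"
  let ?N = "restrict_space borel (sphere 0 1) :: (real ^ 3) measure"
  have meas: "(\<lambda>y. y /\<^sub>R norm y) \<in> measurable ?M ?N"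
  proof (rule measurable_restrict_space2)
    show "(\<lambda>y. y /\<^sub>R norm y) \<in> space ?M \<rightarrow> sphere 0 1"
      by (auto simp: space_restrict_space)
    show "(\<lambda>y. y /\<^sub>R norm y) \<in> borel_measurable ?M"
      by (rule measurable_restrict_space1) measurable
  qed
  have SN: "S \<in> sets ?N" using S by (simp add: sets_sphere_measure)
  have "emeasure lborel U = emeasure lborel (U - {0})"
    using U by (intro emeasure_Diff_null_set[symmetric]) auto
  also have "\<dots> = emeasure ?M (U - {0})"
    using U by (intro emeasure_restrict_space[symmetric]) auto
  also have "\<dots> \<le> emeasure ?M ((\<lambda>y. y /\<^sub>R norm y) -` S \<inter> space ?M)"
    using U US by (intro emeasure_mono measurable_sets[OF meas SN]) (auto simp: space_restrict_space)
  finally have "3 * emeasure lborel U \<le> 3 * emeasure ?M ((\<lambda>y. y /\<^sub>R norm y) -` S \<inter> space ?M)"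
    by (rule mult_left_mono) simp
  then show ?thesis
    unfolding sphere_measure_def using SN by (simp add: emeasure_distr[OF meas])
qed

text \<open>Near a maximum point \<open>x\<close>, the polynomial keeps half of its size on a ball inside the unit
  ball, of radius comparable to \<open>5 ^ (- l)\<close>. As \<open>sphere_measure\<close> is
  defined by volumes of cones, this bounds the \<open>L\<^sup>2\<close> norm from below.\<close>

lemma L2_normalised_homogeneous_bound:
  fixes p :: "real ^ 3 \<Rightarrow> complex"
  assumes p: "polynomial_function p" and hom: "\<And>t x. p (t *\<^sub>R x) = t ^ l *\<^sub>R p x"
    and Y: "\<And>x. norm x = 1 \<Longrightarrow> Y x = p x"
    and norm1: "(\<integral>x. Y x * cnj (Y x) \<partial>sphere_measure) = 1" and y: "norm y = 1"
  shows "(cmod (p y))\<^sup>2 \<le> 1728 * 125 ^ l"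
proof -
  have cont: "continuous_on (sphere 0 1) p"
    by (rule continuous_on_polymonial_function[OF p])
  obtain x where x: "norm x = 1" "\<And>y. norm y = 1 \<Longrightarrow> cmod (p y) \<le> cmod (p x)"
  proof -
    have "sphere 0 1 \<noteq> ({} :: (real ^ 3) set)" using y by auto
    then have "\<exists>x\<in>sphere 0 1. \<forall>y\<in>sphere 0 1. cmod (p y) \<le> cmod (p x)"
      using cont by (intro continuous_attains_sup continuous_on_norm) auto
    then show ?thesis using that by auto
  qed
  define M where "M = cmod (p x)"
  have "M\<^sup>2 \<le> 1728 * 125 ^ l"
  proof (cases "M = 0")
    case False
    then have M: "M > 0" by (simp add: M_def)
    \<comment> \<open>Half of the radius \<open>1 / (6 * 5 ^ l)\<close> on which the polynomial
      keeps half of its maximum.\<close>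
    define r :: real where "r = 1 / (12 * 5 ^ l)"
    have "(1::real) \<le> 5 ^ l" by simp
    then have "(1::real) \<le> 12 * 5 ^ l" by linarith
    then have r: "0 < r" "r \<le> 1" by (auto simp: r_def)
    \<comment> \<open>This ball touches the sphere from inside at \<open>x\<close>: it stays in the
      unit ball, and its points are within \<open>2 * r\<close> of \<open>x\<close>.\<close>
    define U where "U = ball ((1 - r) *\<^sub>R x) r"
    have U: "norm y \<le> 1 \<and> M / 2 \<le> cmod (p y)" if "y \<in> U" for y
    proof
      have z: "norm (y - (1 - r) *\<^sub>R x) \<le> r" using that by (simp add: U_def dist_norm norm_minus_commute)
      show "norm y \<le> 1"
        using norm_triangle_ineq[of "y - (1 - r) *\<^sub>R x" "(1 - r) *\<^sub>R x"] z x(1) r by simp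
      have "norm (y - x) \<le> 2 * r"
        using norm_triangle_ineq4[of "y - (1 - r) *\<^sub>R x" "r *\<^sub>R x"] z x(1) r
        by (simp add: algebra_simps)
      then show "M / 2 \<le> cmod (p y)"
        unfolding M_def by (intro homogeneous_polynomial_near_max[OF p hom x]) (auto simp: r_def)
    qed
    let ?g = "\<lambda>x. (cmod (Y x))\<^sup>2"
    have g: "(\<lambda>x. Y x * cnj (Y x)) = (\<lambda>x. complex_of_real (?g x))"
      by (simp only: complex_norm_square)
    \<comment> \<open>A non-integrable function would have integral 0 by convention, so the value 1
      forces integrability.\<close>
    have "integrable sphere_measure (\<lambda>x. complex_of_real (?g x))"
      using norm1 unfolding g by (metis not_integrable_integral_eq zero_neq_one)
    then have int: "integrable sphere_measure ?g"
      by (simp only: complex_of_real_integrable_eq)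
    have int1: "(\<integral>x. ?g x \<partial>sphere_measure) = 1"
      using norm1 unfolding g integral_complex_of_real by (simp only: of_real_eq_1_iff)
    define S where "S = {x \<in> space sphere_measure. (M / 2)\<^sup>2 \<le> ?g x}"
    have "3 * emeasure lborel U \<le> emeasure sphere_measure S"
    proof (rule emeasure_sphere_measure_ge)
      show "S \<in> sets sphere_measure"
        unfolding S_def using borel_measurable_integrable[OF int] by measurable
      show "U \<in> sets borel" "U \<subseteq> cball 0 1" using U by (auto simp: U_def)
      fix y assume y: "y \<in> U" "y \<noteq> 0"
      let ?u = "y /\<^sub>R norm y"
      have "M / 2 \<le> cmod (p y)" using U y by simp
      \<comment> \<open>Since \<open>norm y\<close> is at most 1, moving \<open>y\<close> radially
        out to the sphere does not decrease the modulus of \<open>p\<close>.\<close>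
      also have "p y = norm y ^ l *\<^sub>R p ?u" using hom[of "norm y" ?u] y by simp
      also have "cmod \<dots> \<le> 1 * cmod (p ?u)"
        using U[OF y(1)] by (simp only: norm_scaleR) (intro mult_right_mono, auto simp: power_le_one)
      finally have "M / 2 \<le> cmod (Y ?u)" using Y[of ?u] y by simp
      then show "?u \<in> S" using M y by (simp add: S_def space_sphere_measure power_mono)
    qed
    \<comment> \<open>Markov's inequality bounds the part of the sphere where the modulus is at
      least \<open>M / 2\<close>, because the total integral is 1.\<close>
    also have "\<dots> \<le> ennreal (1 / (M / 2)\<^sup>2 * 1)"
      using integral_Markov_inequality[OF int, of "(M / 2)\<^sup>2"] M int1 by (simp add: S_def)
    also have "emeasure lborel U = ennreal (4 / 3 * pi * r ^ 3)"
      using emeasure_ball[of r "(1 - r) *\<^sub>R x"] r unit_ball_vol_3 by (simp add: U_def)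
    also have "3 * \<dots> = ennreal (4 * pi * r ^ 3)"
      using ennreal_mult[of 3 "4 / 3 * pi * r ^ 3"] r by (simp add: mult.assoc)
    finally have "4 * pi * r ^ 3 \<le> 4 / M\<^sup>2"
      by (simp add: power_divide)
    then have "pi * r ^ 3 * M\<^sup>2 \<le> 1" using M by (simp add: field_simps)
    \<comment> \<open>The factor \<open>pi\<close> is estimated below by 1; the constants 1728 and
      125 are \<open>12 ^ 3\<close> and \<open>5 ^ 3\<close>, from the cube of
      \<open>r\<close>.\<close>
    moreover have "1 * (r ^ 3 * M\<^sup>2) \<le> pi * (r ^ 3 * M\<^sup>2)"
      using pi_gt3 r by (intro mult_right_mono) auto
    ultimately have "r ^ 3 * M\<^sup>2 \<le> 1" by (simp add: mult.assoc)
    moreover have "((5::real) ^ l) ^ 3 = (5 ^ 3) ^ l" by (simp only: mult.commute flip: power_mult)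
    then have "r ^ 3 = 1 / (1728 * 125 ^ l)" by (simp add: r_def power_divide power_mult_distrib)
    ultimately show ?thesis by (simp add: field_simps)
  qed simp
  moreover have "(cmod (p y))\<^sup>2 \<le> M\<^sup>2"
    using x(2)[OF y] by (simp add: M_def power_mono)
  ultimately show ?thesis by linarith
qed

subsection \<open>Termwise application of the Laplace--Beltrami operator\<close>

lemma higher_deriv_sum:
  assumes "finite I" "\<And>i. i \<in> I \<Longrightarrow> f i holomorphic_on A" "open A" "z \<in> A"
  shows "(deriv ^^ n) (\<lambda>z. \<Sum>i\<in>I. f i z) z = (\<Sum>i\<in>I. (deriv ^^ n) (f i) z)"
  using assms(1,2)
proof (induction I rule: finite_induct)
  case empty
  then show ?case by simp
next
  case (insert i I)
  have "(deriv ^^ n) (\<lambda>z. f i z + (\<Sum>i\<in>I. f i z)) z =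
      (deriv ^^ n) (f i) z + (deriv ^^ n) (\<lambda>z. \<Sum>i\<in>I. f i z) z"
    using insert assms(3,4) by (intro higher_deriv_add[where S = A] holomorphic_on_sum) auto
  then show ?case using insert by simp
qed

text \<open>On each coordinate line the Weierstrass test gives uniform convergence of the
  holomorphic continuations, and derivatives of such limits converge too. Bounds on the functions
  alone thus justify differentiating twice under the sum.\<close>

lemma laplace_beltrami_suminf:
  fixes f :: "'a::euclidean_space \<Rightarrow> complex"
  assumes f: "\<And>y. norm y = 1 \<Longrightarrow> f y = (\<Sum>n. H n y)" and x: "norm x = 1"
    and \<delta>: "0 < \<delta>" "\<delta> \<le> 1"
    and hol: "\<And>n b. b \<in> Basis \<Longrightarrow> F n b holomorphic_on ball 0 \<delta>"
    and bound: "\<And>n b z. b \<in> Basis \<Longrightarrow> cmod z < \<delta> \<Longrightarrow> cmod (F n b z) \<le> A n"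
    and A: "summable A"
    and eq: "\<And>n b t. b \<in> Basis \<Longrightarrow> \<bar>t\<bar> < \<delta> \<Longrightarrow>
      H n ((x + t *\<^sub>R b) /\<^sub>R norm (x + t *\<^sub>R b)) = F n b (of_real t)"
  shows "(\<lambda>n. \<Sum>b\<in>Basis. deriv (deriv (F n b)) 0) sums laplace_beltrami f x"
proof -
  have "(\<lambda>n. deriv (deriv (F n b)) 0) sums
      partial_deriv b (partial_deriv b (\<lambda>y. f (y /\<^sub>R norm y))) x" if b: "b \<in> Basis" for b
  proof -
    define G where "G z = (\<Sum>n. F n b z)" for z
    have lim: "uniform_limit (ball 0 \<delta>) (\<lambda>n z. \<Sum>i<n. F i b z) G sequentially"
      unfolding G_def using bound[OF b] A by (intro Weierstrass_m_test) auto
    have hol_sum: "(\<lambda>z. \<Sum>i<n. F i b z) holomorphic_on ball 0 \<delta>" for n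
      using hol[OF b] by (intro holomorphic_on_sum)
    have "G holomorphic_on ball 0 \<delta>"
    proof (rule holomorphic_uniform_sequence[OF open_ball hol_sum])
      fix z :: complex assume "z \<in> ball 0 \<delta>"
      then obtain d where "d > 0" "cball z d \<subseteq> ball 0 \<delta>"
        using open_contains_cball_eq[OF open_ball] by blast
      then show "\<exists>d>0. cball z d \<subseteq> ball 0 \<delta> \<and>
          uniform_limit (cball z d) (\<lambda>n z. \<Sum>i<n. F i b z) G sequentially"
        using uniform_limit_on_subset[OF lim] by blast
    qed
    moreover have "f ((x + t *\<^sub>R b) /\<^sub>R norm (x + t *\<^sub>R b)) = G (of_real t)" if t: "\<bar>t\<bar> < \<delta>" for t
    proof -
      have "norm (x + t *\<^sub>R b) \<noteq> 0"
        using norm_diff_ineq[of x "t *\<^sub>R b"] x b t \<delta> by auto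
      then show ?thesis unfolding G_def using eq[OF b t] by (subst f) auto
    qed
    ultimately have "partial_deriv b (partial_deriv b (\<lambda>y. f (y /\<^sub>R norm y))) x = (deriv ^^ 2) G 0"
      using \<delta>(1) by (simp add: numeral_2_eq_2 partial_deriv_twice_along_line)
    moreover have "(\<lambda>n. (deriv ^^ 2) (\<lambda>z. \<Sum>i<n. F i b z) 0) \<longlonglongrightarrow> (deriv ^^ 2) G 0"
      using \<delta>(1) by (intro higher_deriv_complex_uniform_limit[OF lim])
        (auto intro!: always_eventually hol_sum)
    moreover have "(deriv ^^ 2) (\<lambda>z. \<Sum>i<n. F i b z) 0 = (\<Sum>i<n. (deriv ^^ 2) (F i b) 0)" for n
      using hol[OF b] \<delta>(1) by (intro higher_deriv_sum[where A = "ball 0 \<delta>"]) auto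
    ultimately show ?thesis by (simp add: sums_def numeral_2_eq_2)
  qed
  then show ?thesis unfolding laplace_beltrami_def laplacian_def by (rule sums_sum)
qed

section \<open>Zonal sums and series of them\<close>

text \<open>For an orthonormal family and points of the sphere, this is the reproducing kernel of
  the harmonics of degree \<open>l\<close>.\<close>

definition zonal :: "(nat \<Rightarrow> int \<Rightarrow> real ^ 3 \<Rightarrow> complex) \<Rightarrow> real ^ 3 \<Rightarrow> nat \<Rightarrow> real ^ 3 \<Rightarrow> complex" where
  "zonal Y \<xi> l x = (\<Sum>m\<in>{-int l..int l}. cnj (Y l m \<xi>) * Y l m x)"

lemma orthonormal_spherical_harmonics_polynomials:
  assumes "orthonormal_spherical_harmonics Y"
  obtains P where
    "\<And>l m. m \<in> {-int l..int l} \<Longrightarrow> polynomial_function (P l m)"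
    "\<And>l m t x. m \<in> {-int l..int l} \<Longrightarrow> P l m (t *\<^sub>R x) = t ^ l *\<^sub>R P l m x"
    "\<And>l m x. m \<in> {-int l..int l} \<Longrightarrow> laplacian (P l m) x = 0"
    "\<And>l m x. m \<in> {-int l..int l} \<Longrightarrow> norm x = 1 \<Longrightarrow> Y l m x = P l m x"
    "\<And>l m x. m \<in> {-int l..int l} \<Longrightarrow> norm x = 1 \<Longrightarrow> cmod (P l m x) \<le> sqrt (1728 * 125 ^ l)"
proof -
  \<comment> \<open>The range of \<open>m\<close> is a premise inside the existential, so that
    choice yields a total function \<open>P\<close>.\<close>
  have "\<forall>l m. \<exists>p. m \<in> {-int l..int l} \<longrightarrow> polynomial_function p \<and>
      (\<forall>t x. p (t *\<^sub>R x) = t ^ l *\<^sub>R p x) \<and> (\<forall>x. laplacian p x = 0) \<and> (\<forall>x\<in>sphere 0 1. Y l m x = p x)"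
    using assms unfolding orthonormal_spherical_harmonics_def spherical_harmonic_def by blast
  then obtain P where P: "\<And>l m. m \<in> {-int l..int l} \<Longrightarrow> polynomial_function (P l m) \<and>
      (\<forall>t x. P l m (t *\<^sub>R x) = t ^ l *\<^sub>R P l m x) \<and> (\<forall>x. laplacian (P l m) x = 0) \<and>
      (\<forall>x\<in>sphere 0 1. Y l m x = P l m x)"
    by metis
  have "cmod (P l m x) \<le> sqrt (1728 * 125 ^ l)" if m: "m \<in> {-int l..int l}" and x: "norm x = 1" for l m x
  proof (intro real_le_rsqrt L2_normalised_homogeneous_bound[where Y = "Y l m"])
    show "(\<integral>x. Y l m x * cnj (Y l m x) \<partial>sphere_measure) = 1"
      using assms m unfolding orthonormal_spherical_harmonics_def by simp
  qed (use P[OF m] x in auto)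
  then show ?thesis using P by (intro that[of P]) auto
qed

lemma cmod_zonal_le:
  assumes Y: "orthonormal_spherical_harmonics Y" and "norm \<xi> = 1" "norm x = 1"
  shows "cmod (zonal Y \<xi> l x) \<le> (2 * real l + 1) * (1728 * 125 ^ l)"
proof -
  obtain P where P: "\<And>l m x. m \<in> {-int l..int l} \<Longrightarrow> norm x = 1 \<Longrightarrow> Y l m x = P l m x"
    "\<And>l m x. m \<in> {-int l..int l} \<Longrightarrow> norm x = 1 \<Longrightarrow> cmod (P l m x) \<le> sqrt (1728 * 125 ^ l)"
    using orthonormal_spherical_harmonics_polynomials[OF Y] by metis
  have "cmod (cnj (Y l m \<xi>) * Y l m x) \<le> 1728 * 125 ^ l" if m: "m \<in> {-int l..int l}" for m
  proof -
    have "cmod (cnj (Y l m \<xi>) * Y l m x) \<le> sqrt (1728 * 125 ^ l) * sqrt (1728 * 125 ^ l)"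
      using assms(2,3) P[OF m] by (simp only: norm_mult complex_mod_cnj) (intro mult_mono, auto)
    then show ?thesis by simp
  qed
  then have "cmod (zonal Y \<xi> l x) \<le> real (card {-int l..int l}) * (1728 * 125 ^ l)"
    unfolding zonal_def by (rule sum_norm_bound)
  then show ?thesis by simp
qed

text \<open>The weights are arbitrary so that the result can be iterated. The base 1250 is
  \<open>125 * 5 * 2\<close>: the product of two sup bounds on harmonics, the passage to complex
  lines, and the radial normalisation.\<close>

lemma laplace_beltrami_zonal_series:
  assumes Y: "orthonormal_spherical_harmonics Y" and \<xi>: "norm \<xi> = 1" and x: "norm x = 1"
    and w: "summable (\<lambda>l. \<bar>w l\<bar> * ((2 * real l + 1) * (1728 * 1250 ^ l)))"
    and f: "\<And>y. norm y = 1 \<Longrightarrow> f y = (\<Sum>l. of_real (w l) * zonal Y \<xi> l y)"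
  shows "laplace_beltrami f x = (\<Sum>l. of_real (w l * sphere_eigenvalue l) * zonal Y \<xi> l x)"
proof -
  obtain P where P: "\<And>l m. m \<in> {-int l..int l} \<Longrightarrow> polynomial_function (P l m)"
    "\<And>l m t x. m \<in> {-int l..int l} \<Longrightarrow> P l m (t *\<^sub>R x) = t ^ l *\<^sub>R P l m x"
    "\<And>l m x. m \<in> {-int l..int l} \<Longrightarrow> laplacian (P l m) x = 0"
    "\<And>l m x. m \<in> {-int l..int l} \<Longrightarrow> norm x = 1 \<Longrightarrow> Y l m x = P l m x"
    "\<And>l m x. m \<in> {-int l..int l} \<Longrightarrow> norm x = 1 \<Longrightarrow> cmod (P l m x) \<le> sqrt (1728 * 125 ^ l)"
    using orthonormal_spherical_harmonics_polynomials[OF Y] by blast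
  have "\<forall>l m b. \<exists>Q. m \<in> {-int l..int l} \<longrightarrow> degree Q \<le> l \<and>
      (\<forall>t. P l m (x + t *\<^sub>R b) = poly Q (of_real t))"
    using homogeneous_polynomial_function_line[OF P(1,2)] by metis
  then obtain Q where Q: "\<And>l m b. m \<in> {-int l..int l} \<Longrightarrow> degree (Q l m b) \<le> l"
    "\<And>l m b t. m \<in> {-int l..int l} \<Longrightarrow> P l m (x + t *\<^sub>R b) = poly (Q l m b) (of_real t)"
    by metis
  \<comment> \<open>Continuation of the degree \<open>l\<close> term, extended constantly along
    rays, to complex points of the line through \<open>x\<close> in direction
    \<open>b\<close>.\<close>
  define F where "F l b z = of_real (w l) *
      (\<Sum>m\<in>{-int l..int l}. cnj (P l m \<xi>) * radial_line l (x \<bullet> b) (Q l m b) z)" for l b z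
  have c: "\<bar>x \<bullet> b\<bar> \<le> 1" if "b \<in> Basis" for b
    using Basis_le_norm[OF that, of x] x by simp
  note hol = holomorphic_radial_line[OF c]
  have "(\<lambda>l. \<Sum>b\<in>Basis. deriv (deriv (F l b)) 0) sums laplace_beltrami f x"
  proof (rule laplace_beltrami_suminf[OF f x, where \<delta> = "1 / 4"])
    show "F l b holomorphic_on ball 0 (1 / 4)" if "b \<in> Basis" for l b
      unfolding F_def using hol[OF that] by (intro holomorphic_intros) auto
    show "of_real (w l) * zonal Y \<xi> l ((x + t *\<^sub>R b) /\<^sub>R norm (x + t *\<^sub>R b)) = F l b (of_real t)"
      if b: "b \<in> Basis" and t: "\<bar>t\<bar> < 1 / 4" for l b t
    proof -
      have "x + t *\<^sub>R b \<noteq> 0"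
        using norm_diff_ineq[of x "t *\<^sub>R b"] x b t by auto
      then have "norm ((x + t *\<^sub>R b) /\<^sub>R norm (x + t *\<^sub>R b)) = 1" by simp
      then have "zonal Y \<xi> l ((x + t *\<^sub>R b) /\<^sub>R norm (x + t *\<^sub>R b)) =
          (\<Sum>m\<in>{-int l..int l}. cnj (P l m \<xi>) * P l m ((x + t *\<^sub>R b) /\<^sub>R norm (x + t *\<^sub>R b)))"
        unfolding zonal_def using P(4) \<xi> by (intro sum.cong refl) simp
      also have "\<dots> = (\<Sum>m\<in>{-int l..int l}. cnj (P l m \<xi>) * radial_line l (x \<bullet> b) (Q l m b) (of_real t))"
        using radial_line_of_real[OF P(2) Q(2) x, of _ l b t] b t by (intro sum.cong refl) simp
      finally show ?thesis unfolding F_def by simp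
    qed
    show "cmod (F l b z) \<le> \<bar>w l\<bar> * ((2 * real l + 1) * (1728 * 1250 ^ l))"
      if b: "b \<in> Basis" and z: "cmod z < 1 / 4" for l b z
    proof -
      define M where "M = sqrt (1728 * 125 ^ l)"
      have "cmod (cnj (P l m \<xi>) * radial_line l (x \<bullet> b) (Q l m b) z) \<le> 1728 * 1250 ^ l"
        if m: "m \<in> {-int l..int l}" for m
      proof -
        have "cmod (poly (Q l m b) z) \<le> 5 ^ l * M"
          unfolding M_def using z b x
          by (intro homogeneous_polynomial_line_bound[OF P(2)[OF m] Q(1)[OF m] Q(2)[OF m]] P(5)[OF m]) auto
        then have "cmod (radial_line l (x \<bullet> b) (Q l m b) z) \<le> 2 ^ l * (5 ^ l * M)"
          by (intro order_trans[OF norm_radial_line_le[OF c[OF b] z]] mult_left_mono) auto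
        then have "cmod (cnj (P l m \<xi>) * radial_line l (x \<bullet> b) (Q l m b) z) \<le> M * (2 ^ l * (5 ^ l * M))"
          using P(5)[OF m \<xi>] by (simp only: norm_mult complex_mod_cnj) (intro mult_mono, auto simp: M_def)
        also have "\<dots> = M * M * (2 * 5) ^ l" by (simp only: power_mult_distrib mult_ac)
        also have "\<dots> = 1728 * (125 * (2 * 5)) ^ l"
          unfolding M_def power_mult_distrib[of 125] by (simp only: real_sqrt_mult_self) simp
        finally show ?thesis by simp
      qed
      then have "cmod (\<Sum>m\<in>{-int l..int l}. cnj (P l m \<xi>) * radial_line l (x \<bullet> b) (Q l m b) z)
          \<le> real (card {-int l..int l}) * (1728 * 1250 ^ l)"
        by (rule sum_norm_bound)
      then show ?thesis unfolding F_def by (simp add: norm_mult mult_left_mono)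
    qed
  qed (use w in auto)
  moreover have "(\<Sum>b\<in>Basis. deriv (deriv (F l b)) 0) =
      of_real (w l * sphere_eigenvalue l) * zonal Y \<xi> l x" for l
  proof -
    let ?R = "\<lambda>b m. radial_line l (x \<bullet> b) (Q l m b)"
    have "(deriv ^^ 2) (F l b) 0 =
        of_real (w l) * (\<Sum>m\<in>{-int l..int l}. cnj (P l m \<xi>) * (deriv ^^ 2) (?R b m) 0)" if "b \<in> Basis" for b
    proof -
      have "(deriv ^^ 2) (F l b) 0 = of_real (w l) *
          (deriv ^^ 2) (\<lambda>z. \<Sum>m\<in>{-int l..int l}. cnj (P l m \<xi>) * ?R b m z) 0"
        unfolding F_def[abs_def] using hol[OF that]
        by (intro higher_deriv_cmult[where A = "ball 0 (1 / 4)"] holomorphic_intros) auto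
      also have "(deriv ^^ 2) (\<lambda>z. \<Sum>m\<in>{-int l..int l}. cnj (P l m \<xi>) * ?R b m z) 0 =
          (\<Sum>m\<in>{-int l..int l}. (deriv ^^ 2) (\<lambda>z. cnj (P l m \<xi>) * ?R b m z) 0)"
        using hol[OF that]
        by (intro higher_deriv_sum[where A = "ball 0 (1 / 4)"] holomorphic_intros) auto
      also have "\<dots> = (\<Sum>m\<in>{-int l..int l}. cnj (P l m \<xi>) * (deriv ^^ 2) (?R b m) 0)"
        using hol[OF that]
        by (intro sum.cong refl higher_deriv_cmult[where A = "ball 0 (1 / 4)"]) auto
      finally show ?thesis .
    qed
    \<comment> \<open>The sum over directions moves inside the sum over \<open>m\<close>, so that
      the eigenvalue computation applies to each harmonic separately.\<close>
    then have "(\<Sum>b\<in>Basis. deriv (deriv (F l b)) 0) = of_real (w l) *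
        (\<Sum>m\<in>{-int l..int l}. cnj (P l m \<xi>) * (\<Sum>b\<in>Basis. deriv (deriv (?R b m)) 0))"
      by (simp add: numeral_2_eq_2 sum_distrib_left sum.swap[of _ "Basis"])
    also have "\<dots> = of_real (w l) * (\<Sum>m\<in>{-int l..int l}. cnj (Y l m \<xi>) *
        (of_real (sphere_eigenvalue l) * Y l m x))"
    proof (intro arg_cong2[where f = "(*)"] sum.cong refl)
      fix m assume m: "m \<in> {-int l..int l}"
      show "cnj (P l m \<xi>) = cnj (Y l m \<xi>)" using P(4)[OF m \<xi>] by simp
      show "(\<Sum>b\<in>Basis. deriv (deriv (?R b m)) 0) = of_real (sphere_eigenvalue l) * Y l m x"
        using sum_deriv_deriv_radial_line[OF P(1)[OF m] P(2)[OF m] P(3)[OF m] x Q(2)[OF m]] P(4)[OF m x]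
        by (simp add: sphere_eigenvalue_def algebra_simps)
    qed
    finally show ?thesis unfolding zonal_def by (simp add: sum_distrib_left mult_ac)
  qed
  ultimately show ?thesis by (simp add: sums_iff)
qed

subsection \<open>Mexican needlets\<close>

text \<open>The exponent is quadratic in \<open>l\<close>, so the weight outweighs both the
  polynomial factors and \<open>1250 ^ l\<close>; a geometric series dominates.\<close>

lemma summable_gaussian_weight:
  fixes \<beta> c :: real
  assumes "\<beta> > 0"
  shows "summable (\<lambda>l. (real l * (real l + 1)) ^ k * exp (- (\<beta> * (real l * (real l + 1)))) *
    ((2 * real l + 1) * (c * 1250 ^ l)))"
proof (rule summable_comparison_test_bigo)
  show "summable (\<lambda>l. norm ((1 / 2) ^ l :: real))" by (simp add: summable_geometric)
  show "(\<lambda>l. (real l * (real l + 1)) ^ k * exp (- (\<beta> * (real l * (real l + 1)))) *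
    ((2 * real l + 1) * (c * 1250 ^ l))) \<in> O(\<lambda>l. (1 / 2) ^ l)"
    using assms by real_asymp
qed

text \<open>Each application multiplies the degree \<open>l\<close> weight by
  \<open>- l (l + 1)\<close>. Up to the factor \<open>- B powi (2 * j)\<close> this is one more
  square of the argument of the weight, which raises \<open>s\<close> by one.\<close>

lemma laplace_beltrami_funpow_mexican_needlet:
  assumes Y: "orthonormal_spherical_harmonics Y" and B: "B > 0" and \<xi>: "norm \<xi> = 1" and x: "norm x = 1"
  shows "(laplace_beltrami ^^ k) (mexican_needlet Y B j a \<xi> 1) x =
    (-1) ^ k * of_real (B powi (2 * j * int k)) * mexican_needlet Y B j a \<xi> (Suc k) x"
proof -
  define \<beta> where "\<beta> = inverse (B powi j) ^ 2"
  have \<beta>: "\<beta> > 0" using B by (simp add: \<beta>_def)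
  \<comment> \<open>Indexed with a shift: \<open>w k\<close> belongs to \<open>s = Suc k\<close>,
    the needlet reached after \<open>k\<close> applications.\<close>
  define w where "w k l = mexican_weight (Suc k) (sqrt (- sphere_eigenvalue l) / B powi j)" for k l
  have w: "w k l = \<beta> ^ Suc k * ((real l * (real l + 1)) ^ Suc k * exp (- (\<beta> * (real l * (real l + 1)))))" for k l
  proof -
    have "(sqrt (- sphere_eigenvalue l) / B powi j)\<^sup>2 = \<beta> * (real l * (real l + 1))"
      by (simp add: \<beta>_def sphere_eigenvalue_def power_divide divide_inverse power_inverse power_mult_distrib
          flip: real_sqrt_mult)
    then show ?thesis
      unfolding w_def mexican_weight_def power_mult by (simp add: power_mult_distrib)
  qed
  have step: "w k l * sphere_eigenvalue l = - inverse \<beta> * w (Suc k) l" for k l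
    unfolding w sphere_eigenvalue_def using \<beta> by (simp add: field_simps)
  have summable_w: "summable (\<lambda>l. \<bar>c * w k l\<bar> * ((2 * real l + 1) * (1728 * 1250 ^ l)))" for c k
  proof -
    have "summable (\<lambda>l. \<bar>c\<bar> * \<beta> ^ Suc k * ((real l * (real l + 1)) ^ Suc k *
        exp (- (\<beta> * (real l * (real l + 1)))) * ((2 * real l + 1) * (1728 * 1250 ^ l))))"
      by (intro summable_mult summable_gaussian_weight \<beta>)
    then show ?thesis unfolding w using \<beta> by (simp add: abs_mult mult_ac)
  qed
  have summable_series: "summable (\<lambda>l. of_real (c * w k l) * zonal Y \<xi> l y)" if "norm y = 1" for c k y
  proof (rule summable_comparison_test'[OF summable_w[of c k]])
    show "cmod (of_real (c * w k l) * zonal Y \<xi> l y) \<le> \<bar>c * w k l\<bar> * ((2 * real l + 1) * (1728 * 1250 ^ l))"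
      for l
      unfolding norm_mult norm_of_real
      by (intro mult_left_mono order_trans[OF cmod_zonal_le[OF Y \<xi> that]])
        (auto intro: power_mono)
  qed
  \<comment> \<open>All scalars are absorbed into the weights, which gives the form required for
    applying the operator termwise.\<close>
  have needlet: "of_real c * mexican_needlet Y B j a \<xi> (Suc k) y = (\<Sum>l. of_real (c * sqrt a * w k l) * zonal Y \<xi> l y)"
    if "norm y = 1" for c k y
    using suminf_mult[OF summable_series[OF that, of 1 k], of "of_real c * of_real (sqrt a)"]
    unfolding mexican_needlet_def zonal_def w_def by (simp add: mult.assoc)
  have "(laplace_beltrami ^^ k) (mexican_needlet Y B j a \<xi> 1) x =
    of_real ((- inverse \<beta>) ^ k) * mexican_needlet Y B j a \<xi> (Suc k) x"
    using x
  \<comment> \<open>The point is generalised because applying the operator once more requires the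
    series representation on the whole sphere.\<close>
  proof (induction k arbitrary: x)
    case 0
    then show ?case by simp
  next
    case (Suc k)
    define c where "c = (- inverse \<beta>) ^ k"
    have "laplace_beltrami ((laplace_beltrami ^^ k) (mexican_needlet Y B j a \<xi> 1)) x =
        (\<Sum>l. of_real (c * sqrt a * w k l * sphere_eigenvalue l) * zonal Y \<xi> l x)"
      by (rule laplace_beltrami_zonal_series[OF Y \<xi> Suc.prems summable_w])
        (use Suc.IH in \<open>simp add: c_def needlet del: of_real_power of_real_mult\<close>)
    also have "\<dots> = of_real ((- inverse \<beta>) ^ Suc k) * mexican_needlet Y B j a \<xi> (Suc (Suc k)) x"
      unfolding needlet[OF Suc.prems] mult.assoc step by (simp add: c_def mult_ac)
    finally show ?case by simp
  qed
  also have "(- inverse \<beta>) ^ k = (-1) ^ k * B powi (2 * j * int k)"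
  proof -
    have "inverse \<beta> = B powi (2 * j)"
      by (simp add: \<beta>_def power_inverse mult.commute[of 2 j] power_int_mult)
    then show ?thesis
      by (simp add: power_int_mult flip: power_mult_distrib)
  qed
  finally show ?thesis by simp
qed

theorem proposition2p1:
  fixes Y :: "nat \<Rightarrow> int \<Rightarrow> real ^ 3 \<Rightarrow> complex"
    and B a :: real and j :: int and \<xi> x :: "real ^ 3" and s :: nat
  assumes "orthonormal_spherical_harmonics Y"
    and "B > 1" and "a > 0" and "\<xi> \<in> sphere 0 1"
    and "s > 1" and "x \<in> sphere 0 1"
  shows "mexican_needlet Y B j a \<xi> s x =
    (-1) ^ (s - 1) * of_real (B powi (-2 * j * (int s - 1))) *
    (laplace_beltrami ^^ (s - 1)) (mexican_needlet Y B j a \<xi> 1) x"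
proof -
  have s: "Suc (s - 1) = s" "int (s - 1) = int s - 1" using assms(5) by auto
  \<comment> \<open>The iterated operator yields \<open>?e * ?q * ?N\<close>; solving for the
    needlet uses that the sign squares to 1 and that the two powers of \<open>B\<close> are inverse
    to each other.\<close>
  let ?e = "(-1) ^ (s - 1) :: complex" and ?p = "complex_of_real (B powi (-2 * j * (int s - 1)))"
    and ?q = "complex_of_real (B powi (2 * j * (int s - 1)))" and ?N = "mexican_needlet Y B j a \<xi> s x"
  have "B powi (-2 * j * (int s - 1)) * B powi (2 * j * (int s - 1)) = 1"
    using assms(2) by (simp add: power_int_minus)
  then have pq: "?p * ?q = 1" by (metis of_real_1 of_real_mult)
  have ee: "?e * ?e = 1" by (simp flip: power_mult_distrib)
  have "?e * ?p * (laplace_beltrami ^^ (s - 1)) (mexican_needlet Y B j a \<xi> 1) x = ?e * ?p * (?e * ?q * ?N)"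
    using laplace_beltrami_funpow_mexican_needlet[of Y B \<xi> x "s - 1" j a] assms s by simp
  also have "\<dots> = (?e * ?e) * (?p * ?q) * ?N" by (simp only: mult_ac)
  finally show ?thesis unfolding pq ee by simp
qed

end
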